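(* As formal power series in $q$, \[ \sum_{n\geq 1} \frac{(-1)^n\, 2 q^n}{1+q^n}\,\frac{(-q;q)_{n-1}}{(q;q)_{n-1}} \;=\; \varphi(-q)^2 - \varphi(-q), \] where $\varphi(q)=\sum_{n=-\infty}^{\infty} q^{n^2}$.
   Context: For a non-negative integer $L$, $(a;q)_L=\prod_{i=0}^{L-1}(1-aq^i)$ (so $(a;q)_0=1$). *)

theory Defs
  imports
    "HOL-Computational_Algebra.Formal_Power_Series"
    "HOL-Analysis.Infinite_Sum"
begin

definition q_poch :: "'a::comm_ring_1 \<Rightarrow> 'a \<Rightarrow> nat \<Rightarrow> 'a" where
  "q_poch a q L = (\<Prod>i<L. 1 - a * q ^ i)"

text \<open>
  Infinite sums of formal power series are taken in the library's metric topology on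
  \<open>'a fps\<close>. The sum below is over all integers; it converges for every \<open>q\<close> with zero
  constant term, so in particular for \<open>- fps_X\<close>.
\<close>

definition ramanujan_phi :: "'a::comm_ring_1 fps \<Rightarrow> 'a fps" where
  "ramanujan_phi q = (\<Sum>\<^sub>\<infinity>n::int. q ^ nat (n\<^sup>2))"

end

theory Submission
  imports Defs
begin

text \<open>
  Write \<open>c\<^sub>n = (-1;q)\<^sub>n / (q;q)\<^sub>n\<close>. Since \<open>(-1;q)\<^sub>n / (-q;q)\<^sub>n = 2 / (1 + q\<^sup>n)\<close>, the \<open>n\<close>-th term of
  the series is \<open>2 c\<^sub>n (-q)\<^sup>n / (1 + q\<^sup>n) - c\<^sub>n (-q)\<^sup>n\<close>, the difference of the terms of a
  \<open>q\<close>-Gauss sum and of a \<open>q\<close>-binomial sum; both terms are \<open>1\<close> at \<open>n = 0\<close>. Replacing the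
  argument \<open>-q\<close> by \<open>-z\<close> with \<open>z = q\<^sup>m\<close> turns each sum into a family \<open>R\<^sub>m\<close> with
  \<open>(1 + z)\<^sup>r R\<^sub>m = (1 - z)\<^sup>r R\<^sub>m\<^sub>+\<^sub>1\<close>, where \<open>r = 2\<close> and \<open>r = 1\<close> respectively, because the difference
  telescopes; as \<open>R\<^sub>m\<close> tends to \<open>1\<close>, the sums are the \<open>r\<close>-th powers of
  \<open>(q;q)\<^sub>\<infinity> / (-q;q)\<^sub>\<infinity>\<close>. By Gauss this product is \<open>\<phi>(-q)\<close>, the limit of the finite identity
  \<open>\<Sum>\<^sub>k (-1)\<^sup>k q\<^bsup>k^2\<^esup> / ((q;q)\<^sub>n\<^sub>-\<^sub>k (q;q)\<^sub>n\<^sub>+\<^sub>k) = 1 / ((q;q)\<^sub>n (-q;q)\<^sub>n)\<close>, which telescopes as well.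
  Limits and infinite products are avoided by working modulo \<open>q\<^sup>N\<close> throughout.
\<close>

section \<open>Congruences modulo powers of q, and infinite sums of power series\<close>

lemma fps_X_power_dvd_iff:
  fixes f :: "'a::comm_ring_1 fps"
  shows "fps_X ^ n dvd f \<longleftrightarrow> (\<forall>i<n. fps_nth f i = 0)"
proof
  assume "fps_X ^ n dvd f"
  then show "\<forall>i<n. fps_nth f i = 0"
    by (auto simp: dvd_def fps_X_power_mult_nth)
next
  assume *: "\<forall>i<n. fps_nth f i = 0"
  have "f = fps_X ^ n * fps_shift n f"
    using * by (auto simp: fps_eq_iff fps_X_power_mult_nth)
  then show "fps_X ^ n dvd f"
    by (metis dvd_triv_left)
qed

lemma dvd_fps_cancel_unit:
  fixes f u d :: "'a::field fps"
  assumes "d dvd u * f" and "fps_nth u 0 \<noteq> 0"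
  shows "d dvd f"
proof -
  have "f = inverse u * (u * f)"
    using assms(2) by (simp add: mult.assoc[symmetric] inverse_mult_eq_1)
  then show ?thesis
    using assms(1) by (metis dvd_mult)
qed

lemma dvd_mult_diff:
  fixes a b c d x :: "'a::comm_ring_1"
  assumes "x dvd a - b" and "x dvd c - d"
  shows "x dvd a * c - b * d"
proof -
  have "a * c - b * d = (a - b) * c + b * (c - d)"
    by (simp add: algebra_simps)
  then show ?thesis
    using assms by simp
qed

text \<open>Any finite set between \<open>F n\<close> and \<open>A\<close> has the same sum modulo
  q^n as \<open>F n\<close>, because every extra term is divisible by q^n. Convergence thus becomes
  a family of congruences on finite sums.\<close>

lemma has_sum_fpsI:
  fixes f :: "'b \<Rightarrow> 'a::comm_ring_1 fps"
  assumes fin: "\<And>n. finite (F n)" and sub: "\<And>n. F n \<subseteq> A"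
    and tail: "\<And>n k. k \<in> A - F n \<Longrightarrow> fps_X ^ n dvd f k"
    and lim: "\<And>n. fps_X ^ n dvd L - sum f (F n)"
  shows "(f has_sum L) A"
  unfolding has_sum_def
proof (rule tendsto_fpsI)
  fix n
  have *: "fps_nth (sum f B) n = fps_nth L n"
    if B: "finite B" "F (Suc n) \<subseteq> B" "B \<subseteq> A" for B
  proof -
    have "sum f B = sum f (B - F (Suc n)) + sum f (F (Suc n))"
      using B by (simp add: sum.subset_diff)
    then have "L - sum f B = (L - sum f (F (Suc n))) - sum f (B - F (Suc n))"
      by simp
    moreover have "fps_X ^ Suc n dvd sum f (B - F (Suc n))"
      using B tail by (intro dvd_sum) blast
    ultimately have "fps_X ^ Suc n dvd L - sum f B"
      using lim by (metis dvd_diff)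
    then show ?thesis
      by (simp add: fps_X_power_dvd_iff del: power_Suc)
  qed
  show "\<forall>\<^sub>F B in finite_subsets_at_top A. fps_nth (sum f B) n = fps_nth L n"
    unfolding eventually_finite_subsets_at_top
    using fin sub * by (intro exI[of _ "F (Suc n)"]) blast
qed

section \<open>The q-binomial and q-Gauss summands\<close>

lemma q_poch_0 [simp]: "q_poch a q 0 = 1"
  by (simp add: q_poch_def)

lemma q_poch_Suc: "q_poch a q (Suc n) = q_poch a q n * (1 - a * q ^ n)"
  by (simp add: q_poch_def)

lemma q_poch_Suc_shift: "q_poch a q (Suc n) = (1 - a) * q_poch (a * q) q n"
  unfolding q_poch_def
  by (subst prod.lessThan_Suc_shift) (simp add: mult.assoc)

lemma q_poch_fps_nth_0 [simp]:
  fixes a :: "'a::field fps"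
  assumes "fps_nth a 0 = 0"
  shows "fps_nth (q_poch a fps_X n) 0 = 1"
  using assms by (induction n) (simp_all add: q_poch_Suc)

lemma q_poch_X_mult_minus_X:
  "q_poch fps_X fps_X n * q_poch (- fps_X) fps_X n
     = (\<Prod>i<n. 1 - (fps_X :: 'a::field fps) ^ (2 * Suc i))"
  by (induction n) (simp_all add: q_poch_Suc algebra_simps power_add power2_eq_square
       mult_2 mult_2_right)

definition binomial_term :: "nat \<Rightarrow> nat \<Rightarrow> 'a::field fps" where
  "binomial_term m n = q_poch (- 1) fps_X n * inverse (q_poch fps_X fps_X n) * (- (fps_X ^ m)) ^ n"

text \<open>Summand of the 2phi1 series with a = b = -1, c = -z and argument -z, where z = q^m. The
  argument equals c/(ab), the case that the q-Gauss sum evaluates.\<close>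

definition gauss_term :: "nat \<Rightarrow> nat \<Rightarrow> 'a::field fps" where
  "gauss_term m n = binomial_term m n * q_poch (- 1) fps_X n
     * inverse (q_poch (- (fps_X ^ m)) fps_X n)"

lemma inverse_fps_step:
  fixes p u :: "'a::field fps"
  assumes "fps_nth p 0 \<noteq> 0" "fps_nth u 0 \<noteq> 0"
  shows "inverse (p * u) * u = inverse p"
  using assms by (simp add: fps_inverse_mult mult.assoc inverse_mult_eq_1)

lemma binomial_term_Suc:
  "binomial_term m (Suc n) * (1 - fps_X ^ Suc n)
     = - (binomial_term m n * (1 + fps_X ^ n) * (fps_X :: 'a::field fps) ^ m)"
proof -
  have "inverse (q_poch fps_X fps_X (Suc n)) * (1 - fps_X ^ Suc n)
      = inverse (q_poch fps_X (fps_X :: 'a fps) n)"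
    unfolding q_poch_Suc power_Suc by (rule inverse_fps_step) simp_all
  then show ?thesis
    unfolding binomial_term_def q_poch_Suc[of "- 1"] power_Suc[of "- (fps_X ^ m)"]
    by (simp add: mult_ac del: power_Suc)
qed

lemma gauss_term_Suc:
  assumes "m > 0"
  shows "gauss_term m (Suc n) * (1 - fps_X ^ Suc n) * (1 + fps_X ^ (m + n))
     = - (gauss_term m n * (1 + fps_X ^ n)\<^sup>2 * (fps_X :: 'a::field fps) ^ m)"
proof -
  have *: "inverse (q_poch (- (fps_X ^ m)) fps_X (Suc n)) * (1 + fps_X ^ (m + n))
      = inverse (q_poch (- (fps_X ^ m)) (fps_X :: 'a fps) n)"
    unfolding q_poch_Suc using assms
    by (subst inverse_fps_step[symmetric, where u = "1 + fps_X ^ (m + n)"])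
       (simp_all add: power_add)
  have "gauss_term m (Suc n) * (1 - fps_X ^ Suc n) * (1 + fps_X ^ (m + n))
     = (binomial_term m (Suc n) * (1 - fps_X ^ Suc n)) * q_poch (- 1) fps_X (Suc n)
       * (inverse (q_poch (- (fps_X ^ m)) fps_X (Suc n)) * (1 + (fps_X :: 'a fps) ^ (m + n)))"
    by (simp add: gauss_term_def mult_ac del: power_Suc)
  also have "\<dots> = - (gauss_term m n * (1 + fps_X ^ n)\<^sup>2 * fps_X ^ m)"
    unfolding * binomial_term_Suc
    by (simp add: gauss_term_def q_poch_Suc power2_eq_square mult_ac)
  finally show ?thesis .
qed

lemma binomial_term_shift: "binomial_term (Suc m) n = binomial_term m n * fps_X ^ n"
proof -
  have "(- (fps_X ^ Suc m)) ^ n = (- (fps_X ^ m)) ^ n * (fps_X :: 'a fps) ^ n"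
    by (simp add: power_mult_distrib[symmetric] mult.commute)
  then show ?thesis
    by (simp add: binomial_term_def mult_ac del: power_Suc)
qed

lemma gauss_term_shift:
  assumes "m > 0"
  shows "gauss_term (Suc m) n * (1 + fps_X ^ (m + n))
     = gauss_term m n * (1 + fps_X ^ m) * (fps_X :: 'a::field fps) ^ n"
proof -
  let ?p = "q_poch (- (fps_X ^ m)) fps_X n :: 'a fps"
  let ?p' = "q_poch (- (fps_X ^ Suc m)) fps_X n :: 'a fps"
  \<comment> \<open>Both sides are (-z;q)_{n+1} with z = q^m, split off at its last and at its first
    factor.\<close>
  have "?p * (1 + fps_X ^ (m + n)) = (1 + fps_X ^ m) * ?p'"
    using q_poch_Suc[of "- (fps_X ^ m)" "fps_X :: 'a fps" n]
      q_poch_Suc_shift[of "- (fps_X ^ m)" "fps_X :: 'a fps" n]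
    by (simp add: power_add mult.commute[of _ fps_X])
  moreover have "inverse ?p * ?p = 1" "inverse ?p' * ?p' = 1"
    using assms by (simp_all add: inverse_mult_eq_1 del: power_Suc)
  moreover have "i' * u = i * v" if "p * u = v * p'" "i * p = 1" "i' * p' = 1"
    for i i' p p' u v :: "'a fps"
    using that by algebra
  ultimately have "inverse ?p' * (1 + fps_X ^ (m + n)) = inverse ?p * (1 + fps_X ^ m)"
    by blast
  then have "binomial_term m n * fps_X ^ n * q_poch (- 1) fps_X n * (inverse ?p' * (1 + fps_X ^ (m + n)))
      = binomial_term m n * fps_X ^ n * q_poch (- 1) fps_X n * (inverse ?p * (1 + fps_X ^ m))"
    by (rule arg_cong)
  then show ?thesis
    unfolding gauss_term_def binomial_term_shift by (simp only: mult_ac)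
qed

text \<open>With a the n-th term, z = q^m and y = q^n, the left side is a(1 - y) + az(1 + y), and
  the recurrence in n turns the second summand into the next value of the certificate.\<close>

lemma binomial_term_telescope:
  "(1 + fps_X ^ m) * binomial_term m n - (1 - fps_X ^ m) * binomial_term (Suc m) n
     = binomial_term m n * (1 - fps_X ^ n)
       - binomial_term m (Suc n) * (1 - (fps_X :: 'a::field fps) ^ Suc n)"
  unfolding binomial_term_Suc binomial_term_shift by (simp add: algebra_simps)

lemma gauss_term_telescope:
  assumes "m > 0"
  shows "(1 + fps_X ^ m)\<^sup>2 * gauss_term m n - (1 - fps_X ^ m)\<^sup>2 * gauss_term (Suc m) n
     = (1 + fps_X ^ m) * (gauss_term m n * (1 - fps_X ^ n)
         - gauss_term m (Suc n) * (1 - (fps_X :: 'a::field fps) ^ Suc n))"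
proof -
  \<comment> \<open>In these letters the claim follows from the shift and the recurrence by
    polynomial algebra, once multiplied by 1 + zy. That factor has constant term 1 because m > 0, so
    it can be cancelled.\<close>
  define z y a b c w :: "'a fps" where "z = fps_X ^ m" and "y = fps_X ^ n" and "a = gauss_term m n"
    and "b = gauss_term (Suc m) n" and "c = gauss_term m (Suc n)" and "w = fps_X ^ Suc n"
  note defs = z_def y_def a_def b_def c_def w_def
  have "b * (1 + z * y) = a * (1 + z) * y" "c * (1 - w) * (1 + z * y) = - (a * (1 + y)\<^sup>2 * z)"
    using gauss_term_shift[OF assms, of n] gauss_term_Suc[OF assms, of n]
    unfolding defs power_add by auto
  then have "((1 + z)\<^sup>2 * a - (1 - z)\<^sup>2 * b) * (1 + z * y)
      = ((1 + z) * (a * (1 - y) - c * (1 - w))) * (1 + z * y)"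
    by algebra
  moreover have "fps_nth (1 + z * y) 0 \<noteq> 0"
    using assms by (simp add: z_def)
  then have "1 + z * y \<noteq> 0"
    by (metis fps_zero_nth)
  ultimately show ?thesis
    unfolding defs by (simp del: power_Suc)
qed

lemma dvd_binomial_term:
  assumes "m > 0"
  shows "fps_X ^ n dvd (binomial_term m n :: 'a::field fps)"
proof -
  have "fps_X dvd - ((fps_X :: 'a fps) ^ m)"
    using assms by (simp add: dvd_power)
  then show ?thesis
    unfolding binomial_term_def by (intro dvd_mult dvd_power_same)
qed

lemma dvd_gauss_term: "m > 0 \<Longrightarrow> fps_X ^ n dvd (gauss_term m n :: 'a::field fps)"
  unfolding gauss_term_def by (intro dvd_mult2 dvd_binomial_term)

section \<open>Evaluation of both sums modulo q^N\<close>

lemma sum_telescope_cong: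
  fixes t g :: "nat \<Rightarrow> 'a::comm_ring_1"
  assumes "\<And>n. u * s n - v * t n = k * (g n - g (Suc n))" and "g 0 = 0" and "x dvd g N"
  shows "x dvd u * sum s {..<N} - v * sum t {..<N}"
proof -
  have "u * sum s {..<N} - v * sum t {..<N} = (\<Sum>n<N. k * (g n - g (Suc n)))"
    by (simp add: assms(1)[symmetric] sum_distrib_left sum_subtractf)
  also have "\<dots> = - (k * g N)"
    using assms(2) by (simp add: sum_distrib_left[symmetric] sum_lessThan_telescope')
  finally show ?thesis
    using assms(3) by simp
qed

text \<open>Chaining the steps m = 0, ..., n-1 collects the factors 1 + q^i and 1 - q^i for i = 1,
  ..., n into the two Pochhammer symbols. Keeping them on both sides avoids division.\<close>

lemma iterate_cong:
  fixes R :: "nat \<Rightarrow> 'a::comm_ring_1"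
  assumes "\<And>m. x dvd (1 + q ^ Suc m) ^ r * R m - (1 - q ^ Suc m) ^ r * R (Suc m)"
  shows "x dvd q_poch (- q) q n ^ r * R 0 - q_poch q q n ^ r * R n"
proof (induction n)
  case (Suc n)
  let ?p = "q_poch (- q) q n ^ r" and ?s = "q_poch q q n ^ r"
  have "q_poch (- q) q (Suc n) ^ r * R 0 - q_poch q q (Suc n) ^ r * R (Suc n)
     = (1 + q ^ Suc n) ^ r * (?p * R 0 - ?s * R n)
       + ?s * ((1 + q ^ Suc n) ^ r * R n - (1 - q ^ Suc n) ^ r * R (Suc n))"
    unfolding q_poch_Suc power_mult_distrib power_Suc[of q] minus_mult_left[symmetric] diff_minus_eq_add
    by (simp only: algebra_simps)
  then show ?case
    using Suc assms by simp
qed simp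

text \<open>Stands in for the limit of R_m being 1: at z = q^(N+1) only the term n = 0 survives
  modulo q^N.\<close>

lemma sum_cong_one:
  fixes t :: "nat \<Rightarrow> nat \<Rightarrow> 'a::field fps"
  assumes "N > 0" "t (Suc N) 0 = 1" "\<And>n. n > 0 \<Longrightarrow> fps_X ^ N dvd t (Suc N) n"
  shows "fps_X ^ N dvd sum (t (Suc N)) {..<N} - 1"
proof -
  obtain M where "N = Suc M"
    using assms(1) by (cases N) auto
  then have "sum (t (Suc N)) {..<N} - 1 = (\<Sum>n<M. t (Suc N) (Suc n))"
    using assms(2) by (simp add: sum.lessThan_Suc_shift del: sum.lessThan_Suc)
  then show ?thesis
    using assms(3) by (simp add: dvd_sum)
qed

lemma dvd_binomial_term_index:
  assumes "n > 0"
  shows "fps_X ^ m dvd (binomial_term m n :: 'a::field fps)"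
proof -
  have "fps_X ^ m dvd (- ((fps_X :: 'a fps) ^ m)) ^ n"
    using assms by (cases n) simp_all
  then show ?thesis
    unfolding binomial_term_def by (intro dvd_mult)
qed

text \<open>Here N is at once the modulus, the number of summands and the number of shifts of z. The
  first keeps the boundary term of the telescope invisible, the last makes the final sum congruent
  to 1.\<close>

lemma binomial_sum_cong:
  "fps_X ^ N dvd q_poch (- fps_X) fps_X N * sum (binomial_term 1) {..<N}
     - (q_poch fps_X fps_X N :: 'a::field fps)"
proof (cases "N = 0")
  case False
  \<comment> \<open>The index is offset by one: \<open>?R m\<close> belongs to z = q^(m+1), so
    \<open>?R 0\<close> is the sum at z = q.\<close>
  let ?R = "\<lambda>m. sum (binomial_term (Suc m)) {..<N} :: 'a fps"
  have "fps_X ^ N dvd q_poch (- fps_X) fps_X N ^ 1 * ?R 0 - q_poch fps_X fps_X N ^ 1 * ?R N"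
  proof (rule iterate_cong, unfold power_one_right)
    fix m
    show "fps_X ^ N dvd (1 + fps_X ^ Suc m) * ?R m - (1 - fps_X ^ Suc m) * ?R (Suc m)"
      by (rule sum_telescope_cong[where k = 1 and
            g = "\<lambda>n. binomial_term (Suc m) n * (1 - fps_X ^ n)"])
         (simp_all only: binomial_term_telescope mult_1, simp_all add: dvd_binomial_term)
  qed
  moreover have "fps_X ^ N dvd ?R N - 1"
  proof (rule sum_cong_one)
    fix n :: nat assume "n > 0"
    then show "fps_X ^ N dvd (binomial_term (Suc N) n :: 'a fps)"
      by (intro dvd_trans[OF le_imp_power_dvd dvd_binomial_term_index]) simp_all
  qed (use False in \<open>simp_all add: binomial_term_def\<close>)
  then have "fps_X ^ N dvd q_poch fps_X fps_X N * (?R N - 1)"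
    by (rule dvd_mult)
  ultimately have "fps_X ^ N dvd (q_poch (- fps_X) fps_X N ^ 1 * ?R 0 - q_poch fps_X fps_X N ^ 1 * ?R N)
       + q_poch fps_X fps_X N * (?R N - 1)"
    by (rule dvd_add)
  then show ?thesis
    by (simp add: algebra_simps)
qed simp

lemma gauss_sum_cong:
  "fps_X ^ N dvd (q_poch (- fps_X) fps_X N)\<^sup>2 * sum (gauss_term 1) {..<N}
     - (q_poch fps_X fps_X N :: 'a::field fps)\<^sup>2"
proof (cases "N = 0")
  case False
  let ?R = "\<lambda>m. sum (gauss_term (Suc m)) {..<N} :: 'a fps"
  have "fps_X ^ N dvd q_poch (- fps_X) fps_X N ^ 2 * ?R 0 - q_poch fps_X fps_X N ^ 2 * ?R N"
  proof (rule iterate_cong)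
    fix m
    show "fps_X ^ N dvd (1 + fps_X ^ Suc m)\<^sup>2 * ?R m - (1 - fps_X ^ Suc m)\<^sup>2 * ?R (Suc m)"
      by (rule sum_telescope_cong[where k = "1 + fps_X ^ Suc m" and
            g = "\<lambda>n. gauss_term (Suc m) n * (1 - fps_X ^ n)"])
         (simp_all only: gauss_term_telescope zero_less_Suc, simp_all add: dvd_gauss_term)
  qed
  moreover have "fps_X ^ N dvd ?R N - 1"
  proof (rule sum_cong_one)
    fix n :: nat assume "n > 0"
    then have "fps_X ^ N dvd (binomial_term (Suc N) n :: 'a fps)"
      by (intro dvd_trans[OF le_imp_power_dvd dvd_binomial_term_index]) simp_all
    then show "fps_X ^ N dvd (gauss_term (Suc N) n :: 'a fps)"
      unfolding gauss_term_def by (intro dvd_mult2)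
  qed (use False in \<open>simp_all add: gauss_term_def binomial_term_def\<close>)
  then have "fps_X ^ N dvd (q_poch fps_X fps_X N)\<^sup>2 * (?R N - 1)"
    by (rule dvd_mult)
  ultimately have "fps_X ^ N dvd (q_poch (- fps_X) fps_X N ^ 2 * ?R 0 - q_poch fps_X fps_X N ^ 2 * ?R N)
       + (q_poch fps_X fps_X N)\<^sup>2 * (?R N - 1)"
    by (rule dvd_add)
  then show ?thesis
    by (simp add: algebra_simps)
qed simp

section \<open>Finite form of the theta identity of Gauss\<close>

definition inv_poch :: "nat \<Rightarrow> 'a::field fps" where
  "inv_poch n = inverse (q_poch fps_X fps_X n)"

lemma inv_poch_Suc: "inv_poch (Suc n) * (1 - fps_X ^ Suc n) = (inv_poch n :: 'a::field fps)"
  unfolding inv_poch_def q_poch_Suc power_Suc by (rule inverse_fps_step) simp_all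

lemma inv_poch_mult: "inv_poch n * q_poch fps_X fps_X n = (1 :: 'a::field fps)"
  by (simp add: inv_poch_def inverse_mult_eq_1)

text \<open>Up to the factor 1/(q;q)_{2n} the product of inverses is the Gaussian binomial of 2n
  over n - k. The truncated subtraction is faithful only for k <= n, the range in which it is
  used.\<close>

definition theta_weight :: "nat \<Rightarrow> nat \<Rightarrow> 'a::field fps" where
  "theta_weight n k = (- 1) ^ k * fps_X ^ k\<^sup>2 * (inv_poch (n - k) * inv_poch (n + k))"

text \<open>The telescoping certificate \<open>g\<close> for \<open>theta_weight\<close>, indexed so that \<open>theta_cert n j\<close> is \<open>g (j + 1)\<close>.\<close>

definition theta_cert :: "nat \<Rightarrow> nat \<Rightarrow> 'a::field fps" where
  "theta_cert n j = (- 1) ^ Suc j * fps_X ^ (j * Suc j + Suc n) * (inv_poch (n - j) * inv_poch (Suc (n + j)))"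

text \<open>With x = q^(n-j) and y = q^(n+j+2) everything has a common factor, and what remains is
  (1 - xy) - (1 - x)(1 - y) = x(1 - y) + y(1 - x). The two summands on the right are the two
  certificate values.\<close>

lemma theta_telescope:
  assumes "j < n"
  shows "(1 - fps_X ^ (2 * Suc n)) * theta_weight (Suc n) (Suc j) - theta_weight n (Suc j)
      = theta_cert n j - (theta_cert n (Suc j) :: 'a::field fps)"
proof -
  obtain d where n: "n = Suc (j + d)"
    using assms less_imp_Suc_add by blast
  define x y s a b :: "'a fps" where "x = fps_X ^ Suc d" and "y = fps_X ^ Suc (n + Suc j)"
    and "s = (- 1) ^ Suc j * fps_X ^ (j * Suc j + Suc j)"
    and "a = inv_poch (Suc d)" and "b = inv_poch (Suc (n + Suc j))"
  have ab: "inv_poch d = a * (1 - x)" "inv_poch (Suc (n + j)) = b * (1 - y)"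
    using inv_poch_Suc[of d, symmetric] inv_poch_Suc[of "n + Suc j", symmetric]
    unfolding a_def b_def x_def y_def by simp_all
  have xy: "fps_X ^ (2 * Suc n) = x * y"
    unfolding x_def y_def power_add[symmetric] n by (rule arg_cong[where f = "power fps_X"]) simp
  have "theta_weight (Suc n) (Suc j) = s * (a * b)"
    unfolding theta_weight_def s_def a_def b_def by (simp add: n power2_eq_square add_ac)
  moreover have "theta_weight n (Suc j) = s * (a * (1 - x) * (b * (1 - y)))"
    unfolding theta_weight_def s_def ab[symmetric] by (simp add: n power2_eq_square add_ac)
  moreover have "theta_cert n j = s * x * (a * (b * (1 - y)))"
    unfolding theta_cert_def ab(2)[symmetric] s_def x_def a_def
    by (simp add: n power_add[symmetric] mult.assoc add_ac del: power_Suc)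
  moreover have "theta_cert n (Suc j) = - (s * y * (a * (1 - x) * b))"
    unfolding theta_cert_def ab(1)[symmetric] s_def y_def b_def
    by (simp add: n power_add[symmetric] mult.assoc add_ac del: power_Suc) (simp add: add_ac)
  ultimately show ?thesis
    unfolding xy by algebra
qed

text \<open>At k = 0 the two exponents coincide, so the two contributions are equal; this gives the
  factor 2.\<close>

lemma theta_telescope_0:
  "(1 - fps_X ^ (2 * Suc n)) * theta_weight (Suc n) 0 - theta_weight n 0
      = - (2 * theta_cert n 0 :: 'a::field fps)"
proof -
  define x a :: "'a fps" where "x = fps_X ^ Suc n" and "a = inv_poch (Suc n)"
  have i: "inv_poch n = a * (1 - x)"
    unfolding a_def x_def by (rule inv_poch_Suc[symmetric])
  have x2: "fps_X ^ (2 * Suc n) = x * x"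
    unfolding x_def power_add[symmetric] by (simp add: mult_2)
  have c: "theta_cert n 0 = - (x * (inv_poch n * a))"
    by (simp add: theta_cert_def x_def a_def)
  have w: "theta_weight (Suc n) 0 = a * a" "theta_weight n 0 = inv_poch n * inv_poch n"
    by (simp_all add: theta_weight_def a_def)
  show ?thesis
    unfolding x2 c w i by (simp add: algebra_simps)
qed

text \<open>The index n + 1 has no counterpart at level n, so a single certificate value is left to
  close the telescope.\<close>

lemma theta_telescope_last:
  "(1 - fps_X ^ (2 * Suc n)) * theta_weight (Suc n) (Suc n) = (theta_cert n n :: 'a::field fps)"
proof -
  have "inv_poch (Suc n + Suc n) * (1 - fps_X ^ (2 * Suc n)) = (inv_poch (Suc (n + n)) :: 'a fps)"
    using inv_poch_Suc[of "Suc (n + n)", where ?'a = 'a] by (simp add: mult_2 del: power_Suc)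
  then have "theta_cert n n = (- 1) ^ Suc n * (fps_X :: 'a fps) ^ (n * Suc n + Suc n) * (inv_poch (n - n)
      * (inv_poch (Suc n + Suc n) * (1 - fps_X ^ (2 * Suc n))))"
    unfolding theta_cert_def by simp
  then show ?thesis
    unfolding theta_weight_def by (simp add: power2_eq_square mult_ac add_ac)
qed

text \<open>
  The symmetric sum of \<open>theta_weight n k\<close> over \<open>-n \<le> k \<le> n\<close>, folded at \<open>k = 0\<close> because truncated
  subtraction rules out negative indices.
\<close>

definition theta_trunc :: "nat \<Rightarrow> 'a::field fps" where
  "theta_trunc n = theta_weight n 0 + 2 * (\<Sum>j<n. theta_weight n (Suc j))"

text \<open>The terms with positive index telescope to \<open>theta_cert n 0\<close>; doubled, this
  cancels the contribution of the central term.\<close>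

lemma theta_trunc_Suc: "(1 - fps_X ^ (2 * Suc n)) * theta_trunc (Suc n) = (theta_trunc n :: 'a::field fps)"
proof -
  let ?u = "1 - fps_X ^ (2 * Suc n) :: 'a fps"
  have "?u * (\<Sum>j<Suc n. theta_weight (Suc n) (Suc j)) - (\<Sum>j<n. theta_weight n (Suc j))
      = (\<Sum>j<n. ?u * theta_weight (Suc n) (Suc j) - theta_weight n (Suc j))
        + ?u * theta_weight (Suc n) (Suc n)"
    by (simp add: sum_distrib_left sum_subtractf distrib_left del: power_Suc mult_Suc_right)
  also have "\<dots> = (\<Sum>j<n. theta_cert n j - theta_cert n (Suc j)) + theta_cert n n"
    unfolding theta_telescope_last by (simp add: theta_telescope del: power_Suc mult_Suc_right)
  also have "\<dots> = theta_cert n 0"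
    by (simp add: sum_lessThan_telescope')
  finally have *: "?u * (\<Sum>j<Suc n. theta_weight (Suc n) (Suc j)) - (\<Sum>j<n. theta_weight n (Suc j))
      = theta_cert n 0" .
  have "u * (a + 2 * b) = c + 2 * d" if "u * b - d = e" "u * a - c = - (2 * e)"
    for u a b c d e :: "'a fps"
  proof -
    have "u * (a + 2 * b) = (u * a - c) + 2 * (u * b - d) + (c + 2 * d)"
      by (simp add: algebra_simps)
    then show ?thesis
      unfolding that by simp
  qed
  from this[OF * theta_telescope_0] show ?thesis
    unfolding theta_trunc_def .
qed

lemma theta_trunc_eq:
  "theta_trunc n * (q_poch fps_X fps_X n * q_poch (- fps_X) fps_X n) = (1 :: 'a::field fps)"
proof (induction n)
  case 0
  then show ?case by (simp add: theta_trunc_def theta_weight_def inv_poch_def)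
next
  case (Suc n)
  have "theta_trunc (Suc n) * (q_poch fps_X fps_X (Suc n) * q_poch (- fps_X) fps_X (Suc n))
     = ((1 - fps_X ^ (2 * Suc n)) * theta_trunc (Suc n))
         * (q_poch fps_X fps_X n * q_poch (- fps_X) (fps_X :: 'a fps) n)"
    unfolding q_poch_X_mult_minus_X by (simp add: mult_ac del: power_Suc mult_Suc_right)
  then show ?case
    unfolding theta_trunc_Suc using Suc by simp
qed

text \<open>Each additional factor is 1 - x^i with i > n, hence 1 modulo x^(n+1).\<close>

lemma q_poch_cong:
  "x ^ Suc n dvd q_poch x x n - q_poch x x (n + d)"
proof (induction d)
  case (Suc d)
  have "q_poch x x n - q_poch x x (n + Suc d)
      = (q_poch x x n - q_poch x x (n + d)) + q_poch x x (n + d) * x ^ Suc (n + d)"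
    by (simp add: q_poch_Suc algebra_simps)
  moreover have "x ^ Suc n dvd x ^ Suc (n + d)"
    by (rule le_imp_power_dvd) simp
  ultimately show ?case
    using Suc by (simp only: dvd_add dvd_mult)
qed simp

text \<open>Replacing the three Pochhammer symbols by one another costs an error of order q^(n-k+1)
  only. The factor q^(k^2) makes up the rest, since k^2 >= k.\<close>

lemma theta_weight_cong:
  assumes "k \<le> n"
  shows "fps_X ^ n dvd (- 1) ^ k * fps_X ^ k\<^sup>2
     - (q_poch fps_X fps_X n)\<^sup>2 * (theta_weight n k :: 'a::field fps)"
proof -
  let ?p = "\<lambda>n. q_poch fps_X fps_X n :: 'a fps"
  obtain d where n: "n = d + k"
    using assms by (metis le_add_diff_inverse2)
  have 1: "fps_X ^ Suc d dvd ?p d - ?p n"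
    using q_poch_cong[of "fps_X :: 'a fps" d k] n by simp
  have 2: "fps_X ^ Suc d dvd ?p d - ?p (n + k)"
    using q_poch_cong[of "fps_X :: 'a fps" d "k + k"] n by (simp add: add_ac)
  have "fps_X ^ Suc d dvd ?p (n + k) - ?p n"
    using dvd_diff[OF 1 2] by (simp del: power_Suc)
  with 1 have "fps_X ^ Suc d dvd ?p d * ?p (n + k) - ?p n * ?p n"
    by (rule dvd_mult_diff)
  then have "fps_X ^ Suc d dvd (?p d * ?p (n + k) - ?p n * ?p n) * (inv_poch d * inv_poch (n + k))"
    by (rule dvd_mult2)
  also have "(?p d * ?p (n + k) - ?p n * ?p n) * (inv_poch d * inv_poch (n + k))
      = (inv_poch d * ?p d) * (inv_poch (n + k) * ?p (n + k))
          - (?p n)\<^sup>2 * (inv_poch d * inv_poch (n + k))"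
    by (simp only: left_diff_distrib power2_eq_square) (simp only: mult_ac)
  also have "\<dots> = 1 - (?p n)\<^sup>2 * (inv_poch d * inv_poch (n + k))"
    by (simp only: inv_poch_mult mult_1)
  finally have "(fps_X :: 'a fps) ^ k\<^sup>2 * fps_X ^ Suc d
      dvd fps_X ^ k\<^sup>2 * (1 - (?p n)\<^sup>2 * (inv_poch d * inv_poch (n + k)))"
    by (rule mult_dvd_mono[OF dvd_refl])
  moreover have "(fps_X :: 'a fps) ^ n dvd fps_X ^ k\<^sup>2 * fps_X ^ Suc d"
    unfolding power_add[symmetric] n power2_eq_square
    using le_square[of k] by (intro le_imp_power_dvd) linarith
  ultimately have "fps_X ^ n dvd (- 1) ^ k
      * (fps_X ^ k\<^sup>2 * (1 - (?p n)\<^sup>2 * (inv_poch d * inv_poch (n + k))))"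
    by (meson dvd_mult dvd_trans)
  moreover have "n - k = d"
    using n by simp
  ultimately show ?thesis
    unfolding theta_weight_def by (simp only: right_diff_distrib mult_1 mult_1_right mult_ac)
qed

text \<open>Multiplying the finite identity by (q;q)_n^2 (-q;q)_n leaves exactly (q;q)_n on its
  right side, while the weights become the terms of the theta series modulo q^n.\<close>

lemma theta_cong:
  "fps_X ^ n dvd q_poch (- fps_X) fps_X n * (1 + 2 * (\<Sum>j<n. (- 1) ^ Suc j * fps_X ^ (Suc j)\<^sup>2))
     - (q_poch fps_X fps_X n :: 'a::field fps)"
proof -
  let ?p = "q_poch fps_X fps_X n :: 'a fps" and ?m = "q_poch (- fps_X) fps_X n :: 'a fps"
  let ?S = "1 + 2 * (\<Sum>j<n. (- 1) ^ Suc j * fps_X ^ (Suc j)\<^sup>2) :: 'a fps"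
  let ?D = "\<lambda>k. (- 1) ^ k * fps_X ^ k\<^sup>2 - ?p\<^sup>2 * theta_weight n k"
  have "?S - ?p\<^sup>2 * theta_trunc n = ?D 0 + 2 * (\<Sum>j<n. ?D (Suc j))"
    unfolding theta_trunc_def sum_subtractf sum_distrib_left[symmetric] by (simp add: algebra_simps)
  moreover have "fps_X ^ n dvd ?D 0 + 2 * (\<Sum>j<n. ?D (Suc j))"
    by (intro dvd_add dvd_mult dvd_sum theta_weight_cong) auto
  ultimately have "fps_X ^ n dvd ?S - ?p\<^sup>2 * theta_trunc n"
    by (simp only:)
  then have "fps_X ^ n dvd ?m * (?S - ?p\<^sup>2 * theta_trunc n)"
    by (rule dvd_mult)
  also have "?m * (?S - ?p\<^sup>2 * theta_trunc n) = ?m * ?S - ?p * (theta_trunc n * (?p * ?m))"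
    by (simp only: right_diff_distrib power2_eq_square mult_ac)
  also have "\<dots> = ?m * ?S - ?p"
    by (simp only: theta_trunc_eq mult_1_right)
  finally show ?thesis .
qed

section \<open>The theta function as an infinite sum, and its product form modulo q^n\<close>

lemma ramanujan_phi_minus_X_trunc:
  "fps_X ^ n dvd ramanujan_phi (- fps_X)
     - (1 + 2 * (\<Sum>j<n. (- 1) ^ Suc j * (fps_X :: 'a::field fps) ^ (Suc j)\<^sup>2))"
proof -
  define f :: "int \<Rightarrow> 'a fps" where "f k = (- fps_X) ^ nat (k\<^sup>2)" for k
  define F where "F n = {- int n..int n}" for n
  \<comment> \<open>The sum over \<open>F n\<close> fixes the coefficients below n, so coefficient i
    is read off at \<open>Suc i\<close>.\<close>
  define L where "L = Abs_fps (\<lambda>i. fps_nth (sum f (F (Suc i))) i)"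
  have f_nat: "f (int k) = (- 1) ^ k * fps_X ^ k\<^sup>2" "f (- int k) = f (int k)" for k
  proof -
    have "nat ((int k)\<^sup>2) = k\<^sup>2"
      by (simp add: nat_power_eq)
    then show "f (int k) = (- 1) ^ k * fps_X ^ k\<^sup>2"
      by (simp add: f_def power_minus[of fps_X] minus_one_power_iff)
  qed (simp add: f_def)
  have sum_F: "sum f (F n) = 1 + 2 * (\<Sum>j<n. (- 1) ^ Suc j * fps_X ^ (Suc j)\<^sup>2)" for n
  proof (induction n)
    case (Suc n)
    have "F (Suc n) = insert (int (Suc n)) (insert (- int (Suc n)) (F n))"
      unfolding F_def by auto
    then have "sum f (F (Suc n)) = f (int (Suc n)) + (f (- int (Suc n)) + sum f (F n))"
      by (simp add: F_def)
    then show ?case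
      unfolding f_nat(2) unfolding f_nat(1) Suc by (simp add: algebra_simps del: power_Suc)
  qed (simp add: F_def f_def)
  have tail: "fps_X ^ n dvd f k" if "k \<in> UNIV - F n" for n k
  proof -
    have "n \<le> nat \<bar>k\<bar>"
      using that by (auto simp: F_def)
    also have "\<dots> \<le> (nat \<bar>k\<bar>)\<^sup>2"
      by (simp add: power2_nat_le_imp_le self_le_power power2_eq_square)
    also have "\<dots> = nat (k\<^sup>2)"
      by (metis abs_ge_zero nat_power_eq power2_abs)
    finally have "fps_X ^ n dvd (fps_X :: 'a fps) ^ nat (k\<^sup>2)"
      by (rule le_imp_power_dvd)
    then show ?thesis
      unfolding f_def power_minus[of fps_X] by (rule dvd_mult)
  qed
  have lim: "fps_X ^ n dvd L - sum f (F n)" for n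
    unfolding fps_X_power_dvd_iff
  proof (intro allI impI)
    fix i assume "i < n"
    then have "F (Suc i) \<subseteq> F n"
      by (auto simp: F_def)
    then have "sum f (F n) - sum f (F (Suc i)) = sum f (F n - F (Suc i))"
      by (simp add: sum_diff F_def)
    moreover have "fps_X ^ Suc i dvd sum f (F n - F (Suc i))"
      using tail by (intro dvd_sum) blast
    ultimately have "fps_nth (sum f (F n) - sum f (F (Suc i))) i = 0"
      unfolding fps_X_power_dvd_iff by simp
    then show "fps_nth (L - sum f (F n)) i = 0"
      by (simp add: L_def)
  qed
  have "(f has_sum L) UNIV"
    by (rule has_sum_fpsI[where F = F, OF _ subset_UNIV tail lim]) (simp add: F_def)
  then have "ramanujan_phi (- fps_X) = L"
    unfolding ramanujan_phi_def f_def by (rule infsumI)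
  then show ?thesis
    using lim[of n] unfolding sum_F by (simp only:)
qed

lemma ramanujan_phi_cong:
  "fps_X ^ n dvd q_poch (- fps_X) fps_X n * ramanujan_phi (- fps_X)
     - (q_poch fps_X fps_X n :: 'a::field fps)"
proof -
  let ?m = "q_poch (- fps_X) fps_X n :: 'a fps" and ?p = "q_poch fps_X fps_X n :: 'a fps"
  let ?S = "1 + 2 * (\<Sum>j<n. (- 1) ^ Suc j * fps_X ^ (Suc j)\<^sup>2) :: 'a fps"
  have "?m * ramanujan_phi (- fps_X) - ?p = ?m * (ramanujan_phi (- fps_X) - ?S) + (?m * ?S - ?p)"
    by (simp add: algebra_simps)
  moreover have "fps_X ^ n dvd ?m * (ramanujan_phi (- fps_X) - ?S)"
    by (intro dvd_mult ramanujan_phi_minus_X_trunc)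
  ultimately show ?thesis
    using theta_cong[of n, where ?'a = 'a] by (simp only: dvd_add)
qed

section \<open>Splitting the summand, and the final assembly\<close>

lemma gauss_minus_binomial:
  assumes "n > 0"
  shows "((- 1) ^ n * (2 * fps_X ^ n)) / (1 + fps_X ^ n)
           * (q_poch (- fps_X) fps_X (n - 1) / q_poch fps_X fps_X (n - 1))
         = gauss_term 1 n - (binomial_term 1 n :: 'a::field fps)"
proof -
  obtain k where n: "n = Suc k"
    using assms by (cases n) auto
  define y m p m' p' i :: "'a fps" where "y = fps_X ^ n" and "m = q_poch (- fps_X) fps_X k"
    and "p = q_poch fps_X fps_X k" and "m' = inverse (q_poch (- fps_X) fps_X n)"
    and "p' = inverse (q_poch fps_X fps_X n)" and "i = inverse (1 + y)"
  have y0: "fps_nth y 0 = 0"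
    by (simp add: y_def n)
  have i: "i * (1 + y) = 1"
    unfolding i_def by (rule inverse_mult_eq_1) (simp add: y0)
  have minus: "q_poch (- 1) fps_X n = 2 * m"
    unfolding n m_def q_poch_Suc_shift by simp
  have m': "m' * (m * (1 + y)) = 1"
    using inverse_mult_eq_1[of "q_poch (- fps_X) fps_X n :: 'a fps"]
    by (simp add: m'_def m_def y_def n q_poch_Suc)
  have p': "inverse p = p' * (1 - y)"
    using inv_poch_Suc[of k, where ?'a = 'a] by (simp add: inv_poch_def p_def p'_def y_def n)
  have "((- 1) ^ n * (2 * y)) / (1 + y) * (m / p) = ((- 1) ^ n * (2 * y)) * i * (m * (p' * (1 - y)))"
    unfolding p'[symmetric] i_def by (subst (1 2) fps_divide_unit) (simp_all add: y0 p_def)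
  also have "\<dots> = 2 * m * p' * ((- 1) ^ n * y) * (2 * m) * m' - 2 * m * p' * ((- 1) ^ n * y)"
  proof -
    have "m * m' * (i * (1 + y)) = i * (m' * (m * (1 + y)))"
      by (simp only: mult_ac)
    then have "m * m' = i"
      by (simp only: i m' mult_1_right)
    then have "2 * m * p' * (e * y) * (2 * m) * m' = 2 * m * p' * (e * y) * 2 * i" for e
      by (simp only: mult.assoc)
    \<comment> \<open>This is 2/(1 + y) - 1 = (1 - y)/(1 + y), with the 1 written as
      \<open>i * (1 + y)\<close>.\<close>
    moreover have "e * (2 * y) * i * (m * (p' * (1 - y)))
        = 2 * m * p' * (e * y) * 2 * i - 2 * m * p' * (e * y)" for e
    proof -
      have "2 * m * p' * (e * y) * 2 * i - 2 * m * p' * (e * y) * (i * (1 + y))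
          = e * (2 * y) * i * (m * (p' * (1 - y)))"
        by (simp add: algebra_simps)
      then show ?thesis
        by (simp only: i mult_1_right)
    qed
    ultimately show ?thesis
      by (simp only:)
  qed
  also have "\<dots> = gauss_term 1 n - binomial_term 1 n"
    by (simp add: gauss_term_def binomial_term_def minus m'_def p'_def y_def power_minus[of fps_X])
  finally show ?thesis
    by (simp add: y_def m_def p_def n)
qed

theorem theorem4p5:
  fixes q :: "rat fps"
  defines "q \<equiv> fps_X"
  shows "((\<lambda>n::nat. ((-1) ^ n * (2 * q ^ n)) / (1 + q ^ n)
              * (q_poch (-q) q (n - 1) / q_poch q q (n - 1)))
           has_sum ((ramanujan_phi (-q))\<^sup>2 - ramanujan_phi (-q))) {1..}"
proof -
  let ?t = "\<lambda>n. gauss_term 1 n - binomial_term 1 n :: rat fps"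
  have "(?t has_sum ((ramanujan_phi (-q))\<^sup>2 - ramanujan_phi (-q))) {1..}"
  proof (rule has_sum_fpsI[where F = "\<lambda>n. {1..<n}"])
    fix n k :: nat
    assume "k \<in> {1..} - {1..<n}"
    then have "fps_X ^ n dvd (fps_X :: rat fps) ^ k"
      by (intro le_imp_power_dvd) auto
    moreover have "fps_X ^ k dvd ?t k"
      by (intro dvd_diff dvd_gauss_term dvd_binomial_term) simp_all
    ultimately show "fps_X ^ n dvd ?t k"
      by (rule dvd_trans)
  next
    fix n :: nat
    let ?m = "q_poch (- fps_X) fps_X n :: rat fps" and ?p = "q_poch fps_X fps_X n :: rat fps"
    let ?phi = "ramanujan_phi (- fps_X) :: rat fps"
    let ?G = "sum (gauss_term 1) {..<n} :: rat fps" and ?B = "sum (binomial_term 1) {..<n} :: rat fps"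
    have phi: "fps_X ^ n dvd ?m * ?phi - ?p"
      by (rule ramanujan_phi_cong)
    \<comment> \<open>The theta function and the q-binomial sum satisfy the same congruence, and
      (-q;q)_n is a unit that cancels. The Gauss sum is compared in the same way with the squared
      congruence.\<close>
    have "fps_X ^ n dvd (?m * ?phi - ?p) - (?m * ?B - ?p)"
      using phi binomial_sum_cong by (rule dvd_diff)
    then have "fps_X ^ n dvd ?m * (?phi - ?B)"
      by (simp add: right_diff_distrib)
    then have B: "fps_X ^ n dvd ?phi - ?B"
      by (rule dvd_fps_cancel_unit) simp
    have "fps_X ^ n dvd (?m * ?phi * (?m * ?phi) - ?p * ?p) - (?m\<^sup>2 * ?G - ?p\<^sup>2)"
      using dvd_mult_diff[OF phi phi] gauss_sum_cong by (rule dvd_diff)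
    then have "fps_X ^ n dvd ?m\<^sup>2 * (?phi\<^sup>2 - ?G)"
      by (simp add: right_diff_distrib power2_eq_square mult_ac)
    then have "fps_X ^ n dvd ?phi\<^sup>2 - ?G"
      by (rule dvd_fps_cancel_unit) (simp add: power2_eq_square)
    then have "fps_X ^ n dvd (?phi\<^sup>2 - ?G) - (?phi - ?B)"
      using B by (rule dvd_diff)
    moreover have *: "sum ?t {1..<n} = ?G - ?B"
    proof -
      \<comment> \<open>Both terms are 1 at n = 0, so their difference vanishes there.\<close>
      have "sum ?t {1..<n} = sum ?t {..<n}"
        by (rule sum.mono_neutral_left) (auto simp: gauss_term_def binomial_term_def not_le)
      then show ?thesis
        by (simp add: sum_subtractf)
    qed
    ultimately show "fps_X ^ n dvd (ramanujan_phi (-q))\<^sup>2 - ramanujan_phi (-q) - sum ?t {1..<n}"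
      unfolding q_def * by (simp add: algebra_simps)
  qed auto
  then show ?thesis
    unfolding q_def by (rule has_sum_cong[THEN iffD2, rotated]) (rule gauss_minus_binomial, simp)
qed

end
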